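(* Let $r\in\mathbb{R}^2$ be a root, $t_1,\dots,t_n\in\mathbb{R}^2$ terminals, and let $0<\alpha<\pi/2$ be a restricting angle. Then every optimal flux tree for this input is planar, i.e., no two of its edges cross.
   Context: The root $r$ is placed at the origin. A curve directed towards $r$ is angle-restricted if at every point $p\neq r$ of it the angle between the tangent vector of the curve at $p$ (in the direction of travel; one-sided tangents at breakpoints) and the vector from $p$ to $r$ is at most $\alpha$. A flux tree (angle-restricted Steiner arborescence) for root $r$ and terminals $t_1,\dots,t_n$ is a finite tree drawn in the plane, rooted at $r$, whose nodes include $r$ and all terminals and possibly additional (Steiner) nodes, whose arcs (edges) are rectifiable curves (piecewise smooth away from $r$) directed from the terminals towards the root, all of them angle-restricted. Its length is the sum of the lengths of its arcs; an optimal flux tree is one of minimum length. *)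

theory Defs
  imports "HOL-Analysis.Analysis" "Graph_Theory.Arc_Walk"
begin

section \<open>Curves\<close>

text \<open>Curves are parametrised over the unit interval, as for \<^const>\<open>path\<close>.\<close>

definition inscribed_lengths :: "(real \<Rightarrow> real^2) \<Rightarrow> real set" where
  "inscribed_lengths g =
     {\<Sum>i<m. dist (g (s i)) (g (s (Suc i))) | (s :: nat \<Rightarrow> real) m.
        mono_on {..m} s \<and> s ` {..m} \<subseteq> {0..1}}"

definition rectifiable :: "(real \<Rightarrow> real^2) \<Rightarrow> bool" where
  "rectifiable g \<longleftrightarrow> path g \<and> bdd_above (inscribed_lengths g)"

definition curve_length :: "(real \<Rightarrow> real^2) \<Rightarrow> real" where
  "curve_length g = Sup (inscribed_lengths g)"

text \<open>
  Derivatives at the ends of a piece are one-sided, and the derivative extends continuously to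
  them, so that one-sided tangents exist at breakpoints. (The library's
  \<^const>\<open>piecewise_C1_differentiable_on\<close> demands nothing at breakpoints.)
\<close>

definition smooth_piece :: "(real \<Rightarrow> real^2) \<Rightarrow> real \<Rightarrow> real \<Rightarrow> bool" where
  "smooth_piece g a b \<longleftrightarrow>
     (\<exists>D. continuous_on {a..b} D \<and>
          (\<forall>x\<in>{a..b}. D x \<noteq> 0 \<and> (g has_vector_derivative D x) (at x within {a..b})))"

definition piecewise_smooth :: "(real \<Rightarrow> real^2) \<Rightarrow> real \<Rightarrow> real \<Rightarrow> bool" where
  "piecewise_smooth g a b \<longleftrightarrow>
     (\<exists>S. finite S \<and>
          (\<forall>c d. a \<le> c \<and> c < d \<and> d \<le> b \<and> {c<..<d} \<inter> S = {} \<longrightarrow> smooth_piece g c d))"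

text \<open>Infinitely many breakpoints may accumulate at \<open>r\<close>, and no tangent is required there.\<close>

definition piecewise_smooth_away_from :: "real^2 \<Rightarrow> (real \<Rightarrow> real^2) \<Rightarrow> bool" where
  "piecewise_smooth_away_from r g \<longleftrightarrow>
     (\<forall>a b. 0 \<le> a \<and> a < b \<and> b \<le> 1 \<and> r \<notin> g ` {a..b} \<longrightarrow> piecewise_smooth g a b)"

text \<open>Unoriented angle in \<open>[0, pi]\<close>; meaningful for nonzero vectors.\<close>

definition vec_angle :: "real^2 \<Rightarrow> real^2 \<Rightarrow> real" where
  "vec_angle u v = arccos (u \<bullet> v / (norm u * norm v))"

definition tangent_vector :: "(real \<Rightarrow> real^2) \<Rightarrow> real \<Rightarrow> real^2 \<Rightarrow> bool" where
  "tangent_vector g x v \<longleftrightarrow>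
     x \<in> {0..<1} \<and> (g has_vector_derivative v) (at_right x) \<or>
     x \<in> {0<..1} \<and> (g has_vector_derivative v) (at_left x)"

definition angle_restricted :: "real^2 \<Rightarrow> real \<Rightarrow> (real \<Rightarrow> real^2) \<Rightarrow> bool" where
  "angle_restricted r \<alpha> g \<longleftrightarrow>
     (\<forall>x\<in>{0..1}. g x \<noteq> r \<longrightarrow> (\<forall>v. tangent_vector g x v \<longrightarrow> vec_angle v (r - g x) \<le> \<alpha>))"


section \<open>Flux trees\<close>

text \<open>
  A drawn digraph has points of the plane as nodes and curves as arcs.
  A tree with all arcs directed towards \<open>r\<close> is a digraph in which every node has a unique
  directed walk to \<open>r\<close>; this excludes loops, parallel arcs and undirected cycles.
\<close>

type_synonym drawn_digraph = "(real^2, real \<Rightarrow> real^2) pre_digraph"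

definition tree_towards :: "('a, 'b) pre_digraph \<Rightarrow> 'a \<Rightarrow> bool" where
  "tree_towards G r \<longleftrightarrow>
     fin_digraph G \<and> r \<in> verts G \<and> (\<forall>v\<in>verts G. \<exists>!p. pre_digraph.awalk G v p r)"

definition flux_tree :: "real^2 \<Rightarrow> (real^2) set \<Rightarrow> real \<Rightarrow> drawn_digraph \<Rightarrow> bool" where
  "flux_tree r T \<alpha> G \<longleftrightarrow>
     tree_towards G r \<and> T \<subseteq> verts G \<and>
     (\<forall>c\<in>arcs G. pathstart c = tail G c \<and> pathfinish c = head G c \<and>
        rectifiable c \<and> piecewise_smooth_away_from r c \<and> angle_restricted r \<alpha> c)"

definition tree_length :: "drawn_digraph \<Rightarrow> real" where
  "tree_length G = (\<Sum>c\<in>arcs G. curve_length c)"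

definition optimal_flux_tree :: "real^2 \<Rightarrow> (real^2) set \<Rightarrow> real \<Rightarrow> drawn_digraph \<Rightarrow> bool" where
  "optimal_flux_tree r T \<alpha> G \<longleftrightarrow>
     flux_tree r T \<alpha> G \<and> (\<forall>H. flux_tree r T \<alpha> H \<longrightarrow> tree_length G \<le> tree_length H)"

text \<open>
  Distinct edges of a planar drawing meet only in common end nodes; besides transversal crossings
  this excludes touching, overlapping, and edges passing through other nodes.
\<close>

definition planar_drawing :: "drawn_digraph \<Rightarrow> bool" where
  "planar_drawing G \<longleftrightarrow>
     (\<forall>c\<in>arcs G. \<forall>d\<in>arcs G. c \<noteq> d \<longrightarrow>
        path_image c \<inter> path_image d \<subseteq> {tail G c, head G c} \<inter> {tail G d, head G d})"

end

theory Submission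
  imports Defs
begin

text \<open>
  If two arcs meet at a point \<open>p\<close> that is not an end of the first one, make \<open>p\<close> a node on the
  second arc and let the first arc end there, dropping its part after \<open>p\<close>. Every node other than
  the root still has exactly one outgoing arc. Since \<open>\<alpha> < pi / 2\<close>, the distance to the root
  decreases along every arc, so the result is again a tree, and it is strictly shorter.
\<close>

section \<open>Lengths of subpaths\<close>

lemma inscribed_lengths_subpath_subset:
  assumes "0 \<le> u" "u \<le> v" "v \<le> 1"
  shows "inscribed_lengths (subpath u v g) \<subseteq> inscribed_lengths g"
proof
  fix a assume "a \<in> inscribed_lengths (subpath u v g)"
  then obtain s :: "nat \<Rightarrow> real" and m where s: "mono_on {..m} s" "s ` {..m} \<subseteq> {0..1}"
    and a: "a = (\<Sum>i<m. dist (subpath u v g (s i)) (subpath u v g (s (Suc i))))"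
    unfolding inscribed_lengths_def by blast
  define s' where "s' i = (v - u) * s i + u" for i
  have "mono_on {..m} s'"
    using s(1) assms by (auto simp: s'_def monotone_on_def intro!: mult_left_mono)
  moreover have "s' ` {..m} \<subseteq> {0..1}"
  proof -
    have "0 \<le> s' i \<and> s' i \<le> 1" if "i \<le> m" for i
    proof -
      have "0 \<le> s i" "s i \<le> 1" using s(2) that by auto
      then have "0 \<le> (v - u) * s i" "(v - u) * s i \<le> v - u"
        using assms by (auto simp: mult_left_le)
      then show ?thesis using assms by (auto simp: s'_def)
    qed
    then show ?thesis by auto
  qed
  moreover have "a = (\<Sum>i<m. dist (g (s' i)) (g (s' (Suc i))))"
    by (simp add: a s'_def subpath_def)
  ultimately show "a \<in> inscribed_lengths g" unfolding inscribed_lengths_def by blast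
qed

lemma rectifiable_subpath:
  assumes "rectifiable g" "0 \<le> u" "u \<le> v" "v \<le> 1"
  shows "rectifiable (subpath u v g)"
  using assms inscribed_lengths_subpath_subset[of u v g] bdd_above_mono
  unfolding rectifiable_def by (auto intro!: path_subpath)

lemma inscribed_lengths_nonempty: "inscribed_lengths g \<noteq> {}"
proof -
  have "0 \<in> inscribed_lengths g"
    unfolding inscribed_lengths_def
    by (rule CollectI, rule exI[of _ "\<lambda>_. 0"], rule exI[of _ 0]) (simp add: monotone_on_def)
  then show ?thesis by blast
qed

lemma sum_lessThan_add: "(\<Sum>i<m + n. f i) = (\<Sum>i<m. f i) + (\<Sum>i<n. f (m + i))"
  for f :: "nat \<Rightarrow> 'a::comm_monoid_add"
  by (induction n) (simp_all add: add.assoc)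

text \<open>Concatenating a subdivision of each half gives a subdivision of the whole. It has one
  extra chord, from the last node of the first half to the first node of the second, hence an
  inequality.\<close>

lemma inscribed_lengths_join:
  assumes x: "0 \<le> x" "x \<le> 1"
    and "a \<in> inscribed_lengths (subpath 0 x g)" "b \<in> inscribed_lengths (subpath x 1 g)"
  shows "\<exists>c\<in>inscribed_lengths g. a + b \<le> c"
proof -
  obtain s :: "nat \<Rightarrow> real" and m where s: "mono_on {..m} s" "s ` {..m} \<subseteq> {0..1}"
    and a: "a = (\<Sum>i<m. dist (subpath 0 x g (s i)) (subpath 0 x g (s (Suc i))))"
    using assms(3) unfolding inscribed_lengths_def by blast
  obtain t :: "nat \<Rightarrow> real" and n where t: "mono_on {..n} t" "t ` {..n} \<subseteq> {0..1}"
    and b: "b = (\<Sum>i<n. dist (subpath x 1 g (t i)) (subpath x 1 g (t (Suc i))))"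
    using assms(4) unfolding inscribed_lengths_def by blast
  \<comment> \<open>Indices \<open>0..m\<close> carry the first subdivision and
    \<open>Suc m..Suc m + n\<close> the second, each pulled back to the parameters of
    \<open>g\<close>. The extra chord has index \<open>m\<close>.\<close>
  define w where "w i = (if i \<le> m then x * s i else (1 - x) * t (i - Suc m) + x)" for i
  let ?N = "Suc m + n"
  have s01: "0 \<le> x * s i \<and> x * s i \<le> x" if "i \<le> m" for i
    using s(2) that x by (auto simp: mult_left_le image_subset_iff)
  have t01: "x \<le> (1 - x) * t i + x \<and> (1 - x) * t i + x \<le> 1" if "i \<le> n" for i
  proof -
    have "0 \<le> t i" "t i \<le> 1" using t(2) that by auto
    then have "0 \<le> (1 - x) * t i" "(1 - x) * t i \<le> 1 - x"
      using x by (auto simp: mult_left_le)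
    then show ?thesis by auto
  qed
  have "w i \<le> w j" if "i \<le> j" "j \<le> ?N" for i j
  proof -
    consider "j \<le> m" | "i \<le> m" "m < j" | "m < i" by linarith
    then show ?thesis
    proof cases
      case 1
      then show ?thesis
        using s(1) that x by (auto simp: w_def monotone_on_def intro!: mult_left_mono)
    next
      case 2
      then show ?thesis
        using s01[of i] t01[of "j - Suc m"] that by (fastforce simp: w_def)
    next
      case 3
      then have "t (i - Suc m) \<le> t (j - Suc m)"
        using t(1) that by (auto simp: monotone_on_def)
      then show ?thesis using 3 that x by (auto simp: w_def intro!: mult_left_mono)
    qed
  qed
  then have "mono_on {..?N} w" by (auto simp: monotone_on_def)
  moreover have "w ` {..?N} \<subseteq> {0..1}"
  proof -
    have "0 \<le> w i \<and> w i \<le> 1" if "i \<le> ?N" for i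
      using s01[of i] t01[of "i - Suc m"] that x by (auto simp: w_def)
    then show ?thesis by auto
  qed
  moreover have "a + b \<le> (\<Sum>i<?N. dist (g (w i)) (g (w (Suc i))))"
  proof -
    have "(\<Sum>i<m. dist (g (w i)) (g (w (Suc i)))) = a"
      unfolding a by (rule sum.cong) (auto simp: w_def subpath_def)
    moreover have "(\<Sum>i<n. dist (g (w (Suc m + i))) (g (w (Suc (Suc m + i))))) = b"
      unfolding b by (rule sum.cong) (auto simp: w_def subpath_def)
    \<comment> \<open>\<open>del: add_Suc\<close> keeps \<open>Suc m + n\<close> in the form that
      \<open>sum_lessThan_add\<close> splits. The term of index \<open>m\<close> remains and is
      nonnegative.\<close>
    ultimately show ?thesis by (simp add: sum_lessThan_add del: add_Suc)
  qed
  ultimately show ?thesis unfolding inscribed_lengths_def by blast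
qed

text \<open>Superadditivity is the direction needed to bound the length after an arc is split or
  cut.\<close>

lemma curve_length_subpaths_le:
  assumes "rectifiable g" "0 \<le> x" "x \<le> 1"
  shows "curve_length (subpath 0 x g) + curve_length (subpath x 1 g) \<le> curve_length g"
proof -
  have bdd: "bdd_above (inscribed_lengths g)" using assms(1) by (simp add: rectifiable_def)
  have ab: "a + b \<le> curve_length g"
    if "a \<in> inscribed_lengths (subpath 0 x g)" "b \<in> inscribed_lengths (subpath x 1 g)" for a b
    using inscribed_lengths_join[OF assms(2,3) that] cSup_upper[OF _ bdd]
    unfolding curve_length_def by fastforce
  \<comment> \<open>The supremum is taken in two stages: over the second half with \<open>a\<close>
    fixed, then over \<open>a\<close>.\<close>
  have "curve_length (subpath x 1 g) \<le> curve_length g - a"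
    if "a \<in> inscribed_lengths (subpath 0 x g)" for a
    unfolding curve_length_def[of "subpath x 1 g"]
    using ab[OF that] by (intro cSup_least inscribed_lengths_nonempty) (simp add: algebra_simps)
  then have "curve_length (subpath 0 x g) \<le> curve_length g - curve_length (subpath x 1 g)"
    unfolding curve_length_def[of "subpath 0 x g"]
    by (intro cSup_least inscribed_lengths_nonempty) (simp add: algebra_simps)
  then show ?thesis by simp
qed

lemma dist_le_curve_length:
  assumes "rectifiable g"
  shows "dist (pathstart g) (pathfinish g) \<le> curve_length g"
proof -
  \<comment> \<open>The witness is a single chord, with nodes \<open>real 0\<close> and
    \<open>real 1\<close>.\<close>
  have "dist (g 0) (g 1) \<in> inscribed_lengths g"
    unfolding inscribed_lengths_def
    by (rule CollectI, rule exI[of _ real], rule exI[of _ 1]) (auto simp: monotone_on_def)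
  then show ?thesis
    using assms cSup_upper unfolding curve_length_def rectifiable_def pathstart_def pathfinish_def
    by blast
qed


section \<open>Angle-restricted curves\<close>

lemma smooth_piece_subpath:
  assumes "u < v" "smooth_piece g ((v - u) * a + u) ((v - u) * b + u)"
  shows "smooth_piece (subpath u v g) a b"
proof -
  define h where "h x = (v - u) * x + u" for x
  have h: "h ` {a..b} \<subseteq> {h a..h b}"
    using assms(1) by (auto simp: h_def intro!: mult_left_mono)
  obtain D where D: "continuous_on {h a..h b} D"
    "\<And>x. x \<in> {h a..h b} \<Longrightarrow> D x \<noteq> 0 \<and> (g has_vector_derivative D x) (at x within {h a..h b})"
    using assms(2) unfolding smooth_piece_def h_def by blast
  have "continuous_on {a..b} (\<lambda>x. (v - u) *\<^sub>R D (h x))"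
    by (intro continuous_intros continuous_on_compose2[OF D(1) _ h])
      (auto simp: h_def intro!: continuous_intros)
  moreover have "(subpath u v g has_vector_derivative (v - u) *\<^sub>R D (h x)) (at x within {a..b})"
    if "x \<in> {a..b}" for x
  proof -
    have "(h has_vector_derivative (v - u)) (at x within {a..b})"
      unfolding h_def by (auto intro!: derivative_eq_intros)
    moreover have "(g has_vector_derivative D (h x)) (at (h x) within h ` {a..b})"
      using D(2)[of "h x"] h that has_vector_derivative_within_subset by blast
    ultimately have "((g \<circ> h) has_vector_derivative (v - u) *\<^sub>R D (h x)) (at x within {a..b})"
      by (rule vector_diff_chain_within)
    then show ?thesis by (simp add: subpath_def h_def o_def)
  qed
  moreover have "(v - u) *\<^sub>R D (h x) \<noteq> 0" if "x \<in> {a..b}" for x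
  proof -
    have "h x \<in> {h a..h b}" using h that by blast
    then show ?thesis using D(2) assms(1) by auto
  qed
  ultimately show ?thesis unfolding smooth_piece_def by blast
qed

lemma piecewise_smooth_subpath:
  assumes uv: "u < v" and "piecewise_smooth g ((v - u) * a + u) ((v - u) * b + u)"
  shows "piecewise_smooth (subpath u v g) a b"
proof -
  define h where "h x = (v - u) * x + u" for x
  obtain S where S: "finite S"
    "\<And>c d. h a \<le> c \<Longrightarrow> c < d \<Longrightarrow> d \<le> h b \<Longrightarrow> {c<..<d} \<inter> S = {} \<Longrightarrow> smooth_piece g c d"
    using assms(2) unfolding piecewise_smooth_def h_def by blast
  \<comment> \<open>The breakpoints of the subpath are those of \<open>g\<close> pulled back along
    the injective map \<open>h\<close>.\<close>
  have "finite (h -` S)"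
    using S(1) uv by (intro finite_vimageI) (auto simp: h_def inj_def)
  moreover have "smooth_piece (subpath u v g) c d"
    if "a \<le> c" "c < d" "d \<le> b" and disj: "{c<..<d} \<inter> h -` S = {}" for c d
  proof -
    have "y \<notin> S" if "h c < y" "y < h d" for y
    proof
      assume "y \<in> S"
      define x where "x = (y - u) / (v - u)"
      have hx: "h x = y" using uv by (simp add: h_def x_def)
      have "(v - u) * c < (v - u) * x" "(v - u) * x < (v - u) * d"
        using that hx by (auto simp: h_def)
      then have "c < x" "x < d" using uv by auto
      then show False using disj hx \<open>y \<in> S\<close> by auto
    qed
    then have "smooth_piece g (h c) (h d)"
      using that uv by (intro S(2)) (auto simp: h_def)
    then show ?thesis using smooth_piece_subpath[OF uv] by (simp add: h_def)
  qed
  ultimately show ?thesis unfolding piecewise_smooth_def by blast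
qed

lemma piecewise_smooth_away_from_subpath:
  assumes g: "piecewise_smooth_away_from r g" and uv: "0 \<le> u" "u < v" "v \<le> 1"
  shows "piecewise_smooth_away_from r (subpath u v g)"
  unfolding piecewise_smooth_away_from_def
proof (intro allI impI, elim conjE)
  fix a b :: real
  assume ab: "0 \<le> a" "a < b" "b \<le> 1" and r: "r \<notin> subpath u v g ` {a..b}"
  define h where "h x = (v - u) * x + u" for x
  have "(v - u) * b \<le> v - u" using ab uv by (simp add: mult_left_le)
  then have "h b \<le> 1" using uv unfolding h_def by linarith
  moreover have "0 \<le> h a" "h a < h b" using ab uv by (auto simp: h_def)
  moreover have "r \<notin> g ` {h a..h b}"
  proof
    assume "r \<in> g ` {h a..h b}"
    then obtain y where y: "h a \<le> y" "y \<le> h b" "r = g y" by auto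
    define x where "x = (y - u) / (v - u)"
    have hx: "h x = y" using uv by (simp add: h_def x_def)
    have "(v - u) * a \<le> (v - u) * x" "(v - u) * x \<le> (v - u) * b"
      using y hx by (auto simp: h_def)
    then have "a \<le> x" "x \<le> b" using uv by auto
    moreover have "r = subpath u v g x" using hx y by (simp add: subpath_def h_def)
    ultimately show False using r by auto
  qed
  ultimately have "piecewise_smooth g (h a) (h b)"
    using g unfolding piecewise_smooth_away_from_def by blast
  then show "piecewise_smooth (subpath u v g) a b"
    using piecewise_smooth_subpath[OF uv(2)] by (simp add: h_def)
qed

lemma vec_angle_scaleR:
  assumes "0 < k"
  shows "vec_angle (k *\<^sub>R u) v = vec_angle u v"
  using assms by (simp add: vec_angle_def)

text \<open>The affine reparametrisation is increasing, so it keeps left and right apart and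
  rescales tangent vectors by a positive factor, which leaves angles unchanged.\<close>

lemma tangent_vector_subpath:
  assumes uv: "0 \<le> u" "u < v" "v \<le> 1" and w: "tangent_vector (subpath u v g) x w"
  shows "tangent_vector g ((v - u) * x + u) ((1 / (v - u)) *\<^sub>R w)"
proof -
  define h where "h x = (v - u) * x + u" for x
  \<comment> \<open>The derivative is known for the subpath and wanted for \<open>g\<close>, so the
    chain rule is applied to \<open>g = subpath u v g \<circ> k\<close> with the inverse parameter
    map \<open>k\<close>.\<close>
  define k where "k y = (y - u) / (v - u)" for y
  have kh: "k (h y) = y" for y using uv by (simp add: h_def k_def)
  have gk: "subpath u v g \<circ> k = g" using uv by (auto simp: subpath_def k_def)
  have dk: "(k has_vector_derivative 1 / (v - u)) (at (h x) within A)" for A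
    using uv unfolding k_def has_real_derivative_iff_has_vector_derivative[symmetric]
    by (auto intro!: derivative_eq_intros)
  have k_mono: "k y < k z \<longleftrightarrow> y < z" for y z
    using uv by (simp add: k_def divide_strict_right_mono divide_less_cancel)
  have "(g has_vector_derivative (1 / (v - u)) *\<^sub>R w) (at_right (h x))"
    if "(subpath u v g has_vector_derivative w) (at_right x)"
  proof -
    have "k ` {h x<..} \<subseteq> {x<..}" using k_mono[of "h x"] by (auto simp: kh)
    then have "(subpath u v g has_vector_derivative w) (at (k (h x)) within k ` {h x<..})"
      using that has_vector_derivative_within_subset unfolding kh by blast
    from vector_diff_chain_within[OF dk this] show ?thesis by (simp add: gk)
  qed
  moreover have "(g has_vector_derivative (1 / (v - u)) *\<^sub>R w) (at_left (h x))"
    if "(subpath u v g has_vector_derivative w) (at_left x)"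
  proof -
    have "k ` {..<h x} \<subseteq> {..<x}" using k_mono[of _ "h x"] by (auto simp: kh)
    then have "(subpath u v g has_vector_derivative w) (at (k (h x)) within k ` {..<h x})"
      using that has_vector_derivative_within_subset unfolding kh by blast
    from vector_diff_chain_within[OF dk this] show ?thesis by (simp add: gk)
  qed
  \<comment> \<open>The side conditions of \<open>tangent_vector\<close> carry over: a right tangent
    taken before the end of the subpath lies before the end of \<open>g\<close>, and dually for left
    tangents.\<close>
  moreover have "h x \<in> {0..<1}" if "x \<in> {0..<1}"
  proof -
    have "(v - u) * x < v - u" using mult_strict_left_mono[of x 1 "v - u"] that uv by auto
    moreover have "0 \<le> (v - u) * x" using that uv by auto
    ultimately show ?thesis using uv unfolding h_def atLeastLessThan_iff by linarith
  qed
  moreover have "h x \<in> {0<..1}" if "x \<in> {0<..1}"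
  proof -
    have "(v - u) * x \<le> v - u" using that uv by (simp add: mult_left_le)
    moreover have "0 < (v - u) * x" using that uv by auto
    ultimately show ?thesis using uv unfolding h_def greaterThanAtMost_iff by linarith
  qed
  ultimately show ?thesis using w unfolding tangent_vector_def h_def by blast
qed

lemma angle_restricted_subpath:
  assumes g: "angle_restricted r \<alpha> g" and uv: "0 \<le> u" "u < v" "v \<le> 1"
  shows "angle_restricted r \<alpha> (subpath u v g)"
  unfolding angle_restricted_def
proof (intro ballI impI allI)
  fix x w
  assume x: "x \<in> {0..1}" and ne: "subpath u v g x \<noteq> r" and w: "tangent_vector (subpath u v g) x w"
  let ?y = "(v - u) * x + u"
  have "(v - u) * x \<le> v - u" using x uv by (simp add: mult_left_le)
  moreover have "0 \<le> (v - u) * x" using x uv by auto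
  ultimately have "?y \<in> {0..1}" using uv unfolding atLeastAtMost_iff by linarith
  moreover have "g ?y \<noteq> r" using ne by (simp add: subpath_def)
  ultimately have "vec_angle ((1 / (v - u)) *\<^sub>R w) (r - g ?y) \<le> \<alpha>"
    using g tangent_vector_subpath[OF uv w] unfolding angle_restricted_def by blast
  then show "vec_angle w (r - subpath u v g x) \<le> \<alpha>"
    using vec_angle_scaleR[of "1 / (v - u)" w] uv by (simp add: subpath_def)
qed

text \<open>These are the requirements of \<open>flux_tree\<close> on an arc that do not mention the
  digraph; they are what subpaths inherit.\<close>

definition flux_arc :: "real^2 \<Rightarrow> real \<Rightarrow> (real \<Rightarrow> real^2) \<Rightarrow> bool" where
  "flux_arc r \<alpha> c \<longleftrightarrow> rectifiable c \<and> piecewise_smooth_away_from r c \<and> angle_restricted r \<alpha> c"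

text \<open>Strictness of \<open>u < v\<close> matters: a constant curve at a point other than
  \<open>r\<close> has zero derivative and so is not piecewise smooth.\<close>

lemma flux_arc_subpath:
  assumes "flux_arc r \<alpha> g" "0 \<le> u" "u < v" "v \<le> 1"
  shows "flux_arc r \<alpha> (subpath u v g)"
  using assms rectifiable_subpath piecewise_smooth_away_from_subpath angle_restricted_subpath
  unfolding flux_arc_def by auto

section \<open>Monotonicity of the distance to the root\<close>

lemma inner_pos_if_vec_angle_less_pi_half:
  assumes "vec_angle u v \<le> \<alpha>" "\<alpha> < pi / 2" "u \<noteq> 0" "v \<noteq> 0"
  shows "0 < u \<bullet> v"
proof (rule ccontr)
  assume neg: "\<not> 0 < u \<bullet> v"
  \<comment> \<open>Cauchy-Schwarz keeps the quotient in the range where \<open>arccos\<close> is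
    antitone; a nonpositive quotient would then give an angle of at least
    \<open>arccos 0 = pi / 2\<close>.\<close>
  have "\<bar>u \<bullet> v\<bar> \<le> norm u * norm v" by (rule Cauchy_Schwarz_ineq2)
  then have "-1 \<le> u \<bullet> v / (norm u * norm v)"
    using assms by (simp add: le_divide_eq)
  moreover have "u \<bullet> v / (norm u * norm v) \<le> 0"
    using neg by (simp add: divide_le_0_iff)
  ultimately have "arccos 0 \<le> vec_angle u v"
    unfolding vec_angle_def by (rule arccos_le_arccos) simp
  then show False using assms(1,2) unfolding arccos_0 by linarith
qed

text \<open>Induction on the exceptional set: the interval is split at an exceptional point inside
  it, and continuity lets both halves include that point.\<close>

lemma piecewise_DERIV_neg_imp_decreasing:
  fixes f :: "real \<Rightarrow> real"
  assumes "finite S" "a < b" "continuous_on {a..b} f"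
    and "\<And>x. a < x \<Longrightarrow> x < b \<Longrightarrow> x \<notin> S \<Longrightarrow> \<exists>y. DERIV f x :> y \<and> y < 0"
  shows "f b < f a"
  using assms
proof (induction S arbitrary: a b)
  case empty
  then show ?case by (intro DERIV_neg_imp_decreasing_open[of a b f]) auto
next
  case (insert s S)
  show ?case
  proof (cases "a < s \<and> s < b")
    case True
    have "continuous_on {a..s} f" "continuous_on {s..b} f"
      using insert.prems(2) True by (auto elim: continuous_on_subset)
    then have "f b < f s" "f s < f a"
      using True insert.prems(3) by (auto intro!: insert.IH)
    then show ?thesis by simp
  next
    case False
    then show ?thesis using insert.prems by (intro insert.IH) auto
  qed
qed

text \<open>The squared distance has derivative \<open>- 2 * (w \<bullet> (r - c x))\<close> for the
  tangent vector \<open>w\<close>, which is negative because the angle is acute.\<close>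

lemma dist_decreasing_away_from_root:
  assumes c: "flux_arc r \<alpha> c" and \<alpha>: "\<alpha> < pi / 2"
    and ab: "0 \<le> a" "a < b" "b \<le> 1" and r: "r \<notin> c ` {a..b}"
  shows "dist (c b) r < dist (c a) r"
proof -
  obtain S where S: "finite S"
    "\<And>u v. a \<le> u \<Longrightarrow> u < v \<Longrightarrow> v \<le> b \<Longrightarrow> {u<..<v} \<inter> S = {} \<Longrightarrow> smooth_piece c u v"
    using c ab r unfolding flux_arc_def piecewise_smooth_away_from_def piecewise_smooth_def
    by metis
  define f where "f x = (c x - r) \<bullet> (c x - r)" for x
  have cont: "continuous_on {a..b} c"
    using c ab unfolding flux_arc_def rectifiable_def path_def
    by (auto elim: continuous_on_subset)
  have "f b < f a"
  proof (rule piecewise_DERIV_neg_imp_decreasing[OF S(1) ab(2)])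
    show "continuous_on {a..b} f" unfolding f_def by (intro continuous_intros cont)
  next
    fix x assume x: "a < x" "x < b" "x \<notin> S"
    \<comment> \<open>The finite set \<open>S\<close> is closed, so \<open>x\<close> has a closed
      neighbourhood free of breakpoints. On it \<open>c\<close> is one smooth piece with
      \<open>x\<close> in the interior, which yields a two-sided derivative.\<close>
    have "open ({a<..<b} - S)" using S(1) by (intro open_Diff finite_imp_closed) auto
    then obtain e where e: "e > 0" "cball x e \<subseteq> {a<..<b} - S"
      using x open_contains_cball[of "{a<..<b} - S"]
      by (meson DiffI greaterThanLessThan_iff)
    have sub: "{x - e..x + e} \<subseteq> {a<..<b} - S"
      using e(2) by (simp add: cball_eq_atLeastAtMost)
    \<comment> \<open>Used at \<open>x - e\<close> and \<open>x + e\<close> for the bounds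
      \<open>a\<close> and \<open>b\<close>, and at the points between to avoid
      \<open>S\<close>.\<close>
    have "y \<in> {a<..<b} - S" if "x - e \<le> y" "y \<le> x + e" for y
      using sub that by (auto simp del: Diff_iff greaterThanLessThan_iff)
    from this[of "x - e"] this[of "x + e"] this have "smooth_piece c (x - e) (x + e)"
      using e(1) by (intro S(2)) auto
    then obtain w where w: "w \<noteq> 0" "(c has_vector_derivative w) (at x within {x - e..x + e})"
      unfolding smooth_piece_def using e(1) by force
    then have dw: "(c has_vector_derivative w) (at x)"
      using e(1) at_within_interior[of x "{x - e..x + e}"] by (simp add: interior_atLeastAtMost_real)
    have "c x \<noteq> r" using r x by auto
    moreover have "tangent_vector c x w"
      using dw x ab has_vector_derivative_at_within unfolding tangent_vector_def by fastforce
    ultimately have "vec_angle w (r - c x) \<le> \<alpha>"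
      using c x ab unfolding flux_arc_def angle_restricted_def by auto
    then have "0 < w \<bullet> (r - c x)"
      using \<alpha> w(1) \<open>c x \<noteq> r\<close> by (intro inner_pos_if_vec_angle_less_pi_half) auto
    moreover have "(f has_vector_derivative (c x - r) \<bullet> w + w \<bullet> (c x - r)) (at x)"
      unfolding f_def
      by (rule bounded_bilinear.has_vector_derivative[OF bounded_bilinear_inner])
        (use dw in \<open>auto intro!: derivative_eq_intros\<close>)
    then have "DERIV f x :> - (2 * (w \<bullet> (r - c x)))"
      by (simp add: has_real_derivative_iff_has_vector_derivative inner_diff_left inner_diff_right
          inner_commute algebra_simps)
    ultimately show "\<exists>y. DERIV f x :> y \<and> y < 0"
      by (intro exI[of _ "- (2 * (w \<bullet> (r - c x)))"]) auto
  qed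
  then show ?thesis
    by (simp add: f_def dist_norm norm_lt)
qed

text \<open>At \<open>r\<close> there need be no tangent, and breakpoints may accumulate, so the
  derivative argument cannot start there. It is applied on an interval that begins shortly after the
  curve leaves \<open>r\<close>.\<close>

lemma flux_arc_stays_at_root:
  assumes c: "flux_arc r \<alpha> c" and \<alpha>: "\<alpha> < pi / 2"
    and uv: "0 \<le> u" "u \<le> v" "v \<le> 1" and r: "c u = r"
  shows "c v = r"
proof (rule ccontr)
  assume ne: "c v \<noteq> r"
  define f where "f x = dist (c x) r" for x
  have cont: "continuous_on {u..v} c"
    using c uv unfolding flux_arc_def rectifiable_def path_def
    by (auto elim: continuous_on_subset)
  \<comment> \<open>After the last visit \<open>z\<close> to the root the distance would have to decrease from 0.\<close>
  define Z where "Z = {x \<in> {u..v}. c x = r}"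
  have "closed Z" unfolding Z_def
    by (rule continuous_closed_preimage_constant[OF cont]) auto
  then have "compact Z" by (auto simp: Z_def compact_eq_bounded_closed intro: bounded_subset[of "{u..v}"])
  moreover have "Z \<noteq> {}" using r uv by (auto simp: Z_def)
  ultimately obtain z where z: "z \<in> Z" "\<And>x. x \<in> Z \<Longrightarrow> x \<le> z"
    using compact_attains_sup[of Z] by blast
  have zv: "z < v" and cz: "c z = r" "u \<le> z"
    using z(1) ne unfolding Z_def by (auto simp: order_less_le)
  have "continuous_on {z..v} f"
    unfolding f_def using cont cz by (auto intro!: continuous_intros elim: continuous_on_subset)
  moreover have fv: "f v > 0" "f z = 0" using ne cz by (auto simp: f_def)
  \<comment> \<open>Half of \<open>f v\<close> is a value strictly between \<open>f z\<close> and
    \<open>f v\<close>. It places \<open>w\<close> strictly between \<open>z\<close> and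
    \<open>v\<close> with \<open>f w < f v\<close>, whereas the distance must decrease from
    \<open>w\<close> to \<open>v\<close>.\<close>
  ultimately obtain w where w: "z \<le> w" "w \<le> v" "f w = f v / 2"
    using IVT'[of f z "f v / 2" v] zv by auto
  have "w \<noteq> z" "w \<noteq> v" using w fv by auto
  then have zw: "z < w" "w < v" using w by auto
  have "c x \<noteq> r" if "w \<le> x" "x \<le> v" for x
    using z(2)[of x] zw cz(2) that by (auto simp: Z_def)
  then have "r \<notin> c ` {w..v}" by fastforce
  then have "f v < f w"
    unfolding f_def using dist_decreasing_away_from_root[OF c \<alpha>] uv zw cz by auto
  then show False using w fv by auto
qed

text \<open>If the curve ends away from \<open>r\<close>, it cannot have visited \<open>r\<close>
  before, since it would have stayed there.\<close>

lemma flux_arc_dist_decreasing: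
  assumes c: "flux_arc r \<alpha> c" and \<alpha>: "\<alpha> < pi / 2"
    and uv: "0 \<le> u" "u < v" "v \<le> 1" and r: "c u \<noteq> r"
  shows "dist (c v) r < dist (c u) r"
proof (cases "c v = r")
  case False
  have "r \<notin> c ` {u..v}"
  proof
    assume "r \<in> c ` {u..v}"
    then obtain z where "u \<le> z" "z \<le> v" "c z = r" by auto
    then show False using flux_arc_stays_at_root[OF c \<alpha>, of z v] uv False by auto
  qed
  then show ?thesis using dist_decreasing_away_from_root[OF c \<alpha> uv] by blast
qed (use r in auto)


section \<open>Trees towards the root\<close>

text \<open>Any arc leaving \<open>v\<close> extends by a walk from its head to a walk from
  \<open>v\<close> to \<open>r\<close>, so uniqueness of that walk fixes its first arc.\<close>

lemma tree_towards_unique_out_arc: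
  assumes "tree_towards G r" "v \<in> verts G" "v \<noteq> r"
  shows "\<exists>!c. c \<in> arcs G \<and> tail G c = v"
proof -
  interpret fin_digraph G using assms(1) by (simp add: tree_towards_def)
  have uniq: "\<exists>!p. awalk x p r" if "x \<in> verts G" for x
    using assms(1) that by (auto simp: tree_towards_def)
  obtain p where p: "awalk v p r" using uniq assms(2) by blast
  then obtain c q where "p = c # q" using assms(3) by (cases p) (auto simp: awalk_Nil_iff)
  then have c: "c \<in> arcs G" "tail G c = v" using p by (auto simp: awalk_Cons_iff)
  have "d = c" if d: "d \<in> arcs G" "tail G d = v" for d
  proof -
    obtain q' where "awalk (head G d) q' r" using uniq d by (meson head_in_verts)
    then have "awalk v (d # q') r" using d by (simp add: awalk_Cons_iff)
    then have "d # q' = p" using p uniq assms(2) by blast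
    then show ?thesis using \<open>p = c # q\<close> by simp
  qed
  then show ?thesis using c by blast
qed

text \<open>Such an arc would begin a nonempty walk from \<open>r\<close> to \<open>r\<close>,
  competing with the empty one.\<close>

lemma tree_towards_no_arc_from_root:
  assumes "tree_towards G r" "c \<in> arcs G"
  shows "tail G c \<noteq> r"
proof
  assume t: "tail G c = r"
  interpret fin_digraph G using assms(1) by (simp add: tree_towards_def)
  have uniq: "\<exists>!p. awalk x p r" if "x \<in> verts G" for x
    using assms(1) that by (auto simp: tree_towards_def)
  have rv: "r \<in> verts G" using assms(1) by (simp add: tree_towards_def)
  obtain q where "awalk (head G c) q r" using uniq assms(2) by (meson head_in_verts)
  then have "awalk r (c # q) r" using t assms(2) by (simp add: awalk_Cons_iff)
  moreover have "awalk r [] r" using rv by (simp add: awalk_Nil_iff)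
  ultimately show False using uniq[OF rv] by blast
qed

text \<open>The potential \<open>f\<close> excludes cycles: following the unique outgoing arcs
  strictly lowers \<open>f\<close>, so in a finite digraph this ends at \<open>r\<close>, the only
  node without an outgoing arc.\<close>

lemma tree_towardsI:
  fixes f :: "'a \<Rightarrow> real"
  assumes "fin_digraph G" "r \<in> verts G"
    and out: "\<And>v. v \<in> verts G \<Longrightarrow> v \<noteq> r \<Longrightarrow> \<exists>!c. c \<in> arcs G \<and> tail G c = v"
    and root: "\<And>c. c \<in> arcs G \<Longrightarrow> tail G c \<noteq> r"
    and dec: "\<And>c. c \<in> arcs G \<Longrightarrow> f (head G c) < f (tail G c)"
  shows "tree_towards G r"
proof -
  interpret fin_digraph G by fact
  have "\<exists>!p. awalk v p r" if "v \<in> verts G" for v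
    using that
  \<comment> \<open>The values of \<open>f\<close> are real and not well-founded, so the induction
    counts the nodes of smaller potential.\<close>
  proof (induction "card {w \<in> verts G. f w < f v}" arbitrary: v rule: less_induct)
    case less
    show ?case
    proof (cases "v = r")
      case True
      have "p = []" if "awalk r p r" for p
        using that root by (cases p) (auto simp: awalk_Cons_iff)
      moreover have "awalk r [] r" using assms(2) by (simp add: awalk_Nil_iff)
      ultimately show ?thesis using True by blast
    next
      case False
      then obtain c where c: "c \<in> arcs G" "tail G c = v"
        and c_uniq: "\<And>d. d \<in> arcs G \<Longrightarrow> tail G d = v \<Longrightarrow> d = c"
        using out less.prems by metis
      have lt: "f (head G c) < f v" using dec[of c] c by simp
      have "{w \<in> verts G. f w < f (head G c)} \<subset> {w \<in> verts G. f w < f v}"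
        using lt head_in_verts[OF c(1)] by auto
      then have "card {w \<in> verts G. f w < f (head G c)} < card {w \<in> verts G. f w < f v}"
        by (intro psubset_card_mono) auto
      then have IH: "\<exists>!p. awalk (head G c) p r"
        using less.hyps c by auto
      then obtain p where p: "awalk (head G c) p r" by blast
      show ?thesis
      proof (rule ex1I)
        show "awalk v (c # p) r" using p c by (simp add: awalk_Cons_iff)
      next
        fix q assume q: "awalk v q r"
        then obtain d q' where d: "q = d # q'" using False by (cases q) (auto simp: awalk_Nil_iff)
        then have "d = c" "awalk (head G d) q' r" using q c_uniq by (auto simp: awalk_Cons_iff)
        then show "q = c # p" using IH p d by blast
      qed
    qed
  qed
  then show ?thesis using assms(1,2) by (simp add: tree_towards_def)
qed


section \<open>Modifying flux trees\<close>

abbreviation drawing :: "(real^2) set \<Rightarrow> (real \<Rightarrow> real^2) set \<Rightarrow> drawn_digraph" where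
  "drawing V A \<equiv> \<lparr>verts = V, arcs = A, tail = pathstart, head = pathfinish\<rparr>"

text \<open>With the distance to \<open>r\<close> as potential, only local conditions remain to be
  checked after a modification: the arcs are admissible, join nodes, and leave each node other than
  \<open>r\<close> exactly once.\<close>

lemma flux_tree_drawingI:
  assumes "finite V" "finite A" "r \<in> V" "T \<subseteq> V" and \<alpha>: "\<alpha> < pi / 2"
    and arcs: "\<And>c. c \<in> A \<Longrightarrow>
      flux_arc r \<alpha> c \<and> pathstart c \<in> V \<and> pathfinish c \<in> V \<and> pathstart c \<noteq> r"
    and out: "\<And>v. v \<in> V \<Longrightarrow> v \<noteq> r \<Longrightarrow> \<exists>!c. c \<in> A \<and> pathstart c = v"
  shows "flux_tree r T \<alpha> (drawing V A)"
proof -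
  have "fin_digraph (drawing V A)"
    using assms by unfold_locales auto
  moreover have "dist (pathfinish c) r < dist (pathstart c) r" if "c \<in> A" for c
    using flux_arc_dist_decreasing[OF _ \<alpha>, of r c 0 1] arcs[OF that]
    by (auto simp: pathstart_def pathfinish_def)
  ultimately have "tree_towards (drawing V A) r"
    using assms by (intro tree_towardsI[where f = "\<lambda>v. dist v r"]) auto
  then show ?thesis using assms unfolding flux_tree_def flux_arc_def by auto
qed

lemma flux_treeD:
  assumes "flux_tree r T \<alpha> G"
  shows "finite (verts G)" "finite (arcs G)" "r \<in> verts G" "T \<subseteq> verts G"
    and "c \<in> arcs G \<Longrightarrow> flux_arc r \<alpha> c"
    and "c \<in> arcs G \<Longrightarrow> pathstart c \<in> verts G"
    and "c \<in> arcs G \<Longrightarrow> pathfinish c \<in> verts G"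
    and "c \<in> arcs G \<Longrightarrow> pathstart c \<noteq> r"
    and "c \<in> arcs G \<Longrightarrow> tail G c = pathstart c"
    and "c \<in> arcs G \<Longrightarrow> head G c = pathfinish c"
    and "v \<in> verts G \<Longrightarrow> v \<noteq> r \<Longrightarrow> \<exists>!c. c \<in> arcs G \<and> pathstart c = v"
proof -
  have tree: "tree_towards G r" using assms by (simp add: flux_tree_def)
  interpret fin_digraph G using tree by (simp add: tree_towards_def)
  show "finite (verts G)" "finite (arcs G)" by auto
  show "r \<in> verts G" using tree by (simp add: tree_towards_def)
  show "T \<subseteq> verts G" using assms by (simp add: flux_tree_def)
  show "c \<in> arcs G \<Longrightarrow> flux_arc r \<alpha> c" using assms by (simp add: flux_tree_def flux_arc_def)
  have tl: "d \<in> arcs G \<Longrightarrow> tail G d = pathstart d" for d using assms by (simp add: flux_tree_def)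
  then show "c \<in> arcs G \<Longrightarrow> tail G c = pathstart c" .
  have hd: "d \<in> arcs G \<Longrightarrow> head G d = pathfinish d" for d using assms by (simp add: flux_tree_def)
  then show "c \<in> arcs G \<Longrightarrow> head G c = pathfinish c" .
  show "c \<in> arcs G \<Longrightarrow> pathstart c \<in> verts G" using tl tail_in_verts by metis
  show "c \<in> arcs G \<Longrightarrow> pathfinish c \<in> verts G" using hd head_in_verts by metis
  show "c \<in> arcs G \<Longrightarrow> pathstart c \<noteq> r" using tl tree_towards_no_arc_from_root[OF tree] by metis
  show "v \<in> verts G \<Longrightarrow> v \<noteq> r \<Longrightarrow> \<exists>!c. c \<in> arcs G \<and> pathstart c = v"
    using tree_towards_unique_out_arc[OF tree, of v] tl by metis
qed

text \<open>Arcs are the curves themselves, so this also shows that a new curve starting at an old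
  node is not yet an arc.\<close>

lemma arc_eq_if_pathstart_eq:
  assumes "flux_tree r T \<alpha> G" "c \<in> arcs G" "d \<in> arcs G" "pathstart c = pathstart d"
  shows "c = d"
  using flux_treeD(11)[OF assms(1), of "pathstart d"] flux_treeD(6,8)[OF assms(1)] assms(2-4) by metis

lemma path_image_interiorE:
  assumes "p \<in> path_image c" "p \<noteq> pathstart c" "p \<noteq> pathfinish c"
  obtains x where "0 < x" "x < 1" "c x = p"
  using assms by (force simp: path_image_def pathstart_def pathfinish_def order_less_le)

text \<open>Turns a meeting point into a node at no cost in length, leaving all arcs but
  \<open>d\<close> in place.\<close>

lemma subdivide_arc:
  assumes G: "flux_tree r T \<alpha> G" and \<alpha>: "\<alpha> < pi / 2"
    and d: "d \<in> arcs G" and p: "p \<in> path_image d" "p \<notin> verts G"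
  obtains H where "flux_tree r T \<alpha> H" "p \<in> verts H" "arcs G - {d} \<subseteq> arcs H"
    "tree_length H \<le> tree_length G"
proof -
  note D = flux_treeD[OF G]
  obtain y where y: "0 < y" "y < 1" "d y = p"
    using path_image_interiorE[OF p(1)] p(2) D(6,7)[OF d] by metis
  define d1 where "d1 = subpath 0 y d"
  define d2 where "d2 = subpath y 1 d"
  have ends: "pathstart d1 = pathstart d" "pathfinish d1 = p" "pathstart d2 = p"
    "pathfinish d2 = pathfinish d"
    using y by (auto simp: d1_def d2_def) (auto simp: pathstart_def pathfinish_def)
  have arcs12: "flux_arc r \<alpha> d1" "flux_arc r \<alpha> d2"
    using flux_arc_subpath D(5)[OF d] y by (auto simp: d1_def d2_def)
  define A where "A = insert d1 (insert d2 (arcs G - {d}))"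
  \<comment> \<open>Both halves have \<open>p\<close>, which is not a node of \<open>G\<close>, as
    an end, and they start at different points. The length of \<open>A\<close> can therefore be
    summed without collisions.\<close>
  have "d1 \<notin> arcs G" "d2 \<notin> arcs G" "d1 \<noteq> d2"
    using ends p(2) D(6,7) d by metis+
  have "\<exists>!c. c \<in> A \<and> pathstart c = v" if v: "v \<in> insert p (verts G)" "v \<noteq> r" for v
  proof (cases "v = p")
    case True
    then show ?thesis using ends p(2) D(6) d
      unfolding A_def by (intro ex1I[of _ d2]) (simp, metis Diff_iff insert_iff)
  next
    case False
    then obtain c where c: "c \<in> arcs G" "pathstart c = v"
      using ex1_implies_ex[OF D(11)] v by blast
    note c_uniq = arc_eq_if_pathstart_eq[OF G _ c(1), unfolded c(2)]
    show ?thesis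
    proof (intro ex1I conjI)
      \<comment> \<open>Only the start of \<open>d\<close> changes its outgoing arc, to the first
        half \<open>d1\<close>; \<open>d2\<close> leaves the new node \<open>p\<close>.\<close>
      let ?c = "if c = d then d1 else c"
      show "?c \<in> A" "pathstart ?c = v" using c ends by (auto simp: A_def)
      fix e assume "e \<in> A \<and> pathstart e = v"
      then show "e = ?c" using False c_uniq[of e] c_uniq[OF d] ends
        unfolding A_def by auto
    qed
  qed
  moreover have "flux_arc r \<alpha> e \<and> pathstart e \<in> insert p (verts G)
      \<and> pathfinish e \<in> insert p (verts G) \<and> pathstart e \<noteq> r" if e: "e \<in> A" for e
  proof -
    consider "e = d1" | "e = d2" | "e \<in> arcs G" using e unfolding A_def by blast
    then show ?thesis
      by cases (use D(3) D(5-8)[of d] D(5-8)[of e] d ends arcs12 p(2) in auto)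
  qed
  moreover have "finite A" using D(2) by (simp add: A_def)
  ultimately have "flux_tree r T \<alpha> (drawing (insert p (verts G)) A)"
    using D(1,3,4) \<alpha> by (intro flux_tree_drawingI) auto
  moreover have "tree_length (drawing (insert p (verts G)) A) \<le> tree_length G"
  proof -
    have "curve_length d1 + curve_length d2 \<le> curve_length d"
      using curve_length_subpaths_le D(5)[OF d] y by (auto simp: d1_def d2_def flux_arc_def)
    moreover have "(\<Sum>c\<in>A. curve_length c)
        = curve_length d1 + curve_length d2 + (\<Sum>c\<in>arcs G - {d}. curve_length c)"
      unfolding A_def using D(2) \<open>d1 \<notin> arcs G\<close> \<open>d2 \<notin> arcs G\<close> \<open>d1 \<noteq> d2\<close> by simp
    moreover have "tree_length G = curve_length d + (\<Sum>c\<in>arcs G - {d}. curve_length c)"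
      unfolding tree_length_def using D(2) d by (rule sum.remove)
    ultimately show ?thesis unfolding tree_length_def by simp
  qed
  ultimately show ?thesis using that[of "drawing (insert p (verts G)) A"] by (auto simp: A_def)
qed

lemma shorten_arc_through_vertex:
  assumes G: "flux_tree r T \<alpha> G" and \<alpha>: "\<alpha> < pi / 2"
    and c: "c \<in> arcs G" and p: "p \<in> path_image c" "p \<in> verts G"
    and ne: "p \<noteq> pathstart c" "p \<noteq> pathfinish c"
  obtains H where "flux_tree r T \<alpha> H" "tree_length H < tree_length G"
proof -
  note D = flux_treeD[OF G]
  obtain x where x: "0 < x" "x < 1" "c x = p"
    using path_image_interiorE[OF p(1) ne] .
  define c1 where "c1 = subpath 0 x c"
  have ends: "pathstart c1 = pathstart c" "pathfinish c1 = p"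
    using x by (auto simp: c1_def) (auto simp: pathstart_def pathfinish_def)
  have c1: "flux_arc r \<alpha> c1"
    using flux_arc_subpath D(5)[OF c] x by (auto simp: c1_def)
  define A where "A = insert c1 (arcs G - {c})"
  \<comment> \<open>It shares its start with \<open>c\<close>, so as an arc of \<open>G\<close> it
    would equal \<open>c\<close>, yet it ends at \<open>p\<close>.\<close>
  have "c1 \<notin> arcs G"
    using arc_eq_if_pathstart_eq[OF G _ c] ends ne by metis
  have "\<exists>!e. e \<in> A \<and> pathstart e = v" if v: "v \<in> verts G" "v \<noteq> r" for v
  proof -
    obtain e where e: "e \<in> arcs G" "pathstart e = v"
      using ex1_implies_ex[OF D(11)] v by blast
    note e_uniq = arc_eq_if_pathstart_eq[OF G _ e(1), unfolded e(2)]
    show ?thesis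
    proof (intro ex1I conjI)
      let ?e = "if e = c then c1 else e"
      show "?e \<in> A" "pathstart ?e = v" using e ends by (auto simp: A_def)
      fix e' assume "e' \<in> A \<and> pathstart e' = v"
      then show "e' = ?e" using e_uniq[of e'] e_uniq[OF c] ends
        unfolding A_def by auto
    qed
  qed
  moreover have "flux_arc r \<alpha> e \<and> pathstart e \<in> verts G
      \<and> pathfinish e \<in> verts G \<and> pathstart e \<noteq> r" if e: "e \<in> A" for e
  proof -
    consider "e = c1" | "e \<in> arcs G" using e unfolding A_def by blast
    then show ?thesis
      by cases (use D(5-8)[of c] D(5-8)[of e] c ends c1 p(2) in auto)
  qed
  moreover have "finite A" using D(2) by (simp add: A_def)
  ultimately have "flux_tree r T \<alpha> (drawing (verts G) A)"
    using D(1,3,4) \<alpha> by (intro flux_tree_drawingI) auto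
  moreover have "tree_length (drawing (verts G) A) < tree_length G"
  proof -
    have rect: "rectifiable c" using D(5)[OF c] by (simp add: flux_arc_def)
    have "dist p (pathfinish c) \<le> curve_length (subpath x 1 c)"
      using dist_le_curve_length[OF rectifiable_subpath[OF rect, of x 1]] x
      by (simp add: pathstart_def pathfinish_def subpath_def)
    moreover have "curve_length c1 + curve_length (subpath x 1 c) \<le> curve_length c"
      using curve_length_subpaths_le rect x by (auto simp: c1_def)
    moreover have "0 < dist p (pathfinish c)" using ne by simp
    ultimately have "curve_length c1 < curve_length c" by linarith
    moreover have "(\<Sum>e\<in>A. curve_length e)
        = curve_length c1 + (\<Sum>e\<in>arcs G - {c}. curve_length e)"
      unfolding A_def using D(2) \<open>c1 \<notin> arcs G\<close> by simp
    moreover have "tree_length G = curve_length c + (\<Sum>e\<in>arcs G - {c}. curve_length e)"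
      unfolding tree_length_def using D(2) c by (rule sum.remove)
    ultimately show ?thesis unfolding tree_length_def by simp
  qed
  ultimately show ?thesis using that by blast
qed

section \<open>Planarity of optimal flux trees\<close>

theorem mainTheorem3:
  fixes r :: "real^2" and t :: "nat \<Rightarrow> real^2" and n :: nat and \<alpha> :: real
    and G :: drawn_digraph
  assumes "0 < \<alpha>" and "\<alpha> < pi / 2"
    and "optimal_flux_tree r (t ` {1..n}) \<alpha> G"
  shows "planar_drawing G"
  unfolding planar_drawing_def
proof (intro ballI impI subsetI)
  fix c d p
  assume c: "c \<in> arcs G" and d: "d \<in> arcs G" and "c \<noteq> d" and p: "p \<in> path_image c \<inter> path_image d"
  let ?T = "t ` {1..n}"
  have G: "flux_tree r ?T \<alpha> G"
    and opt: "\<And>H. flux_tree r ?T \<alpha> H \<Longrightarrow> tree_length G \<le> tree_length H"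
    using assms(3) by (auto simp: optimal_flux_tree_def)
  note D = flux_treeD[OF G]
  have "p \<in> verts G"
  proof (rule ccontr)
    assume nv: "p \<notin> verts G"
    \<comment> \<open>Subdividing \<open>d\<close> leaves \<open>c\<close> intact because
      \<open>c \<noteq> d\<close>. In \<open>G'\<close> the arc \<open>c\<close> then passes through
      the node \<open>p\<close> away from its ends and can be shortened.\<close>
    obtain G' where G': "flux_tree r ?T \<alpha> G'" "p \<in> verts G'" "arcs G - {d} \<subseteq> arcs G'"
      "tree_length G' \<le> tree_length G"
      using subdivide_arc[OF G assms(2) d _ nv] p by blast
    have "p \<noteq> pathstart c" "p \<noteq> pathfinish c" using nv D(6,7)[OF c] by auto
    then obtain H where "flux_tree r ?T \<alpha> H" "tree_length H < tree_length G'"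
      using shorten_arc_through_vertex[OF G'(1) assms(2) _ _ G'(2), of c] p c \<open>c \<noteq> d\<close> G'(3)
      by blast
    then show False using opt G'(4) by fastforce
  qed
  \<comment> \<open>Once \<open>p\<close> is a node of \<open>G\<close>, shortening applies to
    \<open>G\<close> itself, so \<open>p\<close> is an end of every arc through it, in particular of
    both \<open>c\<close> and \<open>d\<close>.\<close>
  then have "p = pathstart e \<or> p = pathfinish e" if "e \<in> arcs G" "p \<in> path_image e" for e
    using shorten_arc_through_vertex[OF G assms(2) that(1,2)] opt by (metis not_le)
  then show "p \<in> {tail G c, head G c} \<inter> {tail G d, head G d}"
    using p c d D(9,10) by auto
qed

end
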